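(* Let $N\ge 1$ and let $\mathcal{A}=\{x_1,\dots,x_M\}\subset\mathbb{C}$, $M\ge 2$, be the unit-modulus $M$-PSK constellation. Let $\epsilon_m\in(0,1)$, $N_{s,d}>0$, $N_{r_m,d}>0$ for $m=1,\dots,N$. Let $y_{s,d}[n-1],y_{s,d}[n],y_{r_m,d}[n-1],y_{r_m,d}[n]\in\mathbb{C}$ be given observations, and for $x\in\mathcal{A}$ let $p(x)$ be the joint conditional likelihood of $(y_{s,d}[n],y_{r_1,d}[n],\dots,y_{r_N,d}[n])$ given the previous observations and $x[n]=x$, as defined in the context. Then the set of maximizers of $p(x)$ over $x\in\mathcal{A}$ (the maximum likelihood decisions) coincides with $$\arg\max_{x\in\mathcal{A}}\Big\{\tfrac{1}{N_{s,d}}\mathrm{Re}\{y_{s,d}^*[n]\,y_{s,d}[n-1]\,x\}+\sum_{m=1}^{N}\ln\Big((1-\epsilon_m)e^{\frac{1}{N_{r_m,d}}\mathrm{Re}\{y_{r_m,d}^*[n]y_{r_m,d}[n-1]x\}}+\frac{\epsilon_m}{M-1}\sum_{i:\,x_i\ne x}e^{\frac{1}{N_{r_m,d}}\mathrm{Re}\{y_{r_m,d}^*[n]y_{r_m,d}[n-1]x_i\}}\Big)\Big\}.$$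
   Context: Here $^*$ is complex conjugation. $\mathcal{CN}(\mu,\eta)$ denotes the circular complex Gaussian law with density $z\mapsto\frac{1}{\pi\eta}e^{-|z-\mu|^2/\eta}$ on $\mathbb{C}$. Model (differential decode-and-forward cooperation with $N$ relays). The source sends the data symbol $x[n]\in\mathcal{A}$. Relay $m$ demodulates it to $x_m[n]\in\mathcal{A}$, with $x_m[n]=x[n]$ with probability $1-\epsilon_m$ and $x_m[n]$ equal to each of the $M-1$ other constellation points with probability $\epsilon_m/(M-1)$, and retransmits it to the destination. Conditionally on the previous received samples and the sent symbols, the destination treats the signals as independent with laws $y_{s,d}[n]\sim\mathcal{CN}(y_{s,d}[n-1]x[n],\,2N_{s,d})$ and $y_{r_m,d}[n]\sim\mathcal{CN}(y_{r_m,d}[n-1]x_m[n],\,2N_{r_m,d})$. Accordingly $$p(x)=\frac{e^{-\frac{|y_{s,d}[n]-y_{s,d}[n-1]x|^2}{2N_{s,d}}}}{2\pi N_{s,d}}\prod_{m=1}^N\Big[(1-\epsilon_m)\phi_m(x)+\frac{\epsilon_m}{M-1}\sum_{i:\,x_i\neq x}\phi_m(x_i)\Big],\qquad \phi_m(x)=\frac{1}{2\pi N_{r_m,d}}e^{-\frac{|y_{r_m,d}[n]-y_{r_m,d}[n-1]x|^2}{2N_{r_m,d}}}.$$ *)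

theory Defs
  imports "HOL-Analysis.Analysis"
begin

text \<open>
  The points \<open>x\<^sub>1, \<dots>, x\<^sub>M\<close> of the unit-modulus \<open>M\<close>-PSK constellation. The phase offset
  \<open>\<theta>\<close> covers the different conventions for where the constellation starts
  (\<open>\<theta> = 0\<close> gives the \<open>M\<close>-th roots of unity).
\<close>

definition psk_point :: "nat \<Rightarrow> real \<Rightarrow> nat \<Rightarrow> complex" where
  "psk_point M \<theta> i = cis (\<theta> + 2 * pi * (real i - 1) / real M)"

definition psk :: "nat \<Rightarrow> real \<Rightarrow> complex set" where
  "psk M \<theta> = psk_point M \<theta> ` {1..M}"

text \<open>The density at \<open>z\<close> of the circular complex Gaussian law with mean \<open>\<mu>\<close> and variance \<open>\<eta>\<close>.\<close>

definition cn_density :: "complex \<Rightarrow> real \<Rightarrow> complex \<Rightarrow> real" where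
  "cn_density \<mu> \<eta> z = 1 / (pi * \<eta>) * exp (- (cmod (z - \<mu>))\<^sup>2 / \<eta>)"

text \<open>
  The density of a received sample \<open>y\<close>, given the previous sample \<open>y'\<close> on the same link and the
  symbol \<open>x\<close> sent over it; \<open>N0\<close> is \<open>N\<^sub>s\<^sub>,\<^sub>d\<close> for the direct link and \<open>N\<^sub>r\<^sub>m\<^sub>,\<^sub>d\<close> for relay \<open>m\<close>, where it
  is the function \<open>\<phi>\<^sub>m\<close>.
\<close>

definition link_density :: "real \<Rightarrow> complex \<Rightarrow> complex \<Rightarrow> complex \<Rightarrow> real" where
  "link_density N0 y' y x = cn_density (y' * x) (2 * N0) y"

text \<open>
  The joint conditional likelihood \<open>p(x)\<close>. Primed observations are those at time \<open>n - 1\<close>, the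
  unprimed ones those at time \<open>n\<close>; quantities depending on a relay are indexed by \<open>1, \<dots>, N\<close>.
\<close>

definition likelihood ::
  "nat \<Rightarrow> nat \<Rightarrow> real \<Rightarrow> (nat \<Rightarrow> real) \<Rightarrow> real \<Rightarrow> (nat \<Rightarrow> real) \<Rightarrow>
   complex \<Rightarrow> complex \<Rightarrow> (nat \<Rightarrow> complex) \<Rightarrow> (nat \<Rightarrow> complex) \<Rightarrow> complex \<Rightarrow> real" where
  "likelihood N M \<theta> \<epsilon> Nsd Nrd ysd' ysd yrd' yrd x =
     link_density Nsd ysd' ysd x *
     (\<Prod>m=1..N.
        (1 - \<epsilon> m) * link_density (Nrd m) (yrd' m) (yrd m) x +
        \<epsilon> m / (real M - 1) *
          (\<Sum>i | i \<in> {1..M} \<and> psk_point M \<theta> i \<noteq> x.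
             link_density (Nrd m) (yrd' m) (yrd m) (psk_point M \<theta> i)))"

text \<open>
  The lemma \<open>likelihood_eq_marginal\<close> below derives this formula from the model: the relays decide
  independently for symbols \<open>s 1, \<dots>, s N\<close>, and \<open>p(x)\<close> is obtained by summing these out.
\<close>

definition relay_prob :: "nat \<Rightarrow> real \<Rightarrow> complex \<Rightarrow> complex \<Rightarrow> real" where
  "relay_prob M e x x' = (if x' = x then 1 - e else e / (real M - 1))"

lemma inj_on_psk_point: "inj_on (psk_point M \<theta>) {1..M}"
proof (rule inj_onI)
  fix i j assume i: "i \<in> {1..M}" and j: "j \<in> {1..M}" and eq: "psk_point M \<theta> i = psk_point M \<theta> j"
  have M: "M > 0" using i by auto
  have "cis (2 * pi * real (i - 1) / real M) = cis (2 * pi * real (j - 1) / real M)"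
    using eq i j by (simp add: psk_point_def cis_mult[symmetric] of_nat_diff)
  moreover have "i - 1 \<in> {..<M}" "j - 1 \<in> {..<M}" using i j by auto
  ultimately have "i - 1 = j - 1"
    using Complex.bij_betw_roots_unity[OF M] by (auto simp: bij_betw_def inj_on_def)
  thus "i = j" using i j by auto
qed

lemma sum_relay_prob:
  assumes "x \<in> psk M \<theta>"
  shows "(\<Sum>x'\<in>psk M \<theta>. relay_prob M e x x' * f x') =
     (1 - e) * f x + e / (real M - 1) * (\<Sum>i | i \<in> {1..M} \<and> psk_point M \<theta> i \<noteq> x. f (psk_point M \<theta> i))"
proof -
  let ?I = "{i. i \<in> {1..M} \<and> psk_point M \<theta> i \<noteq> x}"
  have fin: "finite (psk M \<theta>)" by (simp add: psk_def)
  have im: "psk M \<theta> - {x} = psk_point M \<theta> ` ?I" by (auto simp: psk_def)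
  have inj: "inj_on (psk_point M \<theta>) ?I" by (rule inj_on_subset[OF inj_on_psk_point]) auto
  have "(\<Sum>x'\<in>psk M \<theta>. relay_prob M e x x' * f x') =
      (1 - e) * f x + (\<Sum>x'\<in>psk M \<theta> - {x}. e / (real M - 1) * f x')"
    by (subst sum.remove[OF fin assms]) (auto simp: relay_prob_def intro!: sum.cong)
  also have "(\<Sum>x'\<in>psk M \<theta> - {x}. e / (real M - 1) * f x') =
      e / (real M - 1) * (\<Sum>i\<in>?I. f (psk_point M \<theta> i))"
    unfolding im sum_distrib_left by (subst sum.reindex[OF inj]) simp
  finally show ?thesis .
qed

lemma likelihood_eq_marginal:
  assumes "x \<in> psk M \<theta>"
  shows "likelihood N M \<theta> \<epsilon> Nsd Nrd ysd' ysd yrd' yrd x =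
    (\<Sum>s\<in>PiE {1..N} (\<lambda>_. psk M \<theta>).
       (\<Prod>m=1..N. relay_prob M (\<epsilon> m) x (s m)) *
       (link_density Nsd ysd' ysd x *
        (\<Prod>m=1..N. link_density (Nrd m) (yrd' m) (yrd m) (s m))))"
proof -
  have fin: "finite (psk M \<theta>)" by (simp add: psk_def)
  have "likelihood N M \<theta> \<epsilon> Nsd Nrd ysd' ysd yrd' yrd x = link_density Nsd ysd' ysd x *
      (\<Prod>m=1..N. \<Sum>x'\<in>psk M \<theta>. relay_prob M (\<epsilon> m) x x' * link_density (Nrd m) (yrd' m) (yrd m) x')"
    unfolding likelihood_def sum_relay_prob[OF assms] ..
  also have "\<dots> = link_density Nsd ysd' ysd x * (\<Sum>s\<in>PiE {1..N} (\<lambda>_. psk M \<theta>).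
      \<Prod>m=1..N. relay_prob M (\<epsilon> m) x (s m) * link_density (Nrd m) (yrd' m) (yrd m) (s m))"
    by (subst prod_sum_PiE) (use fin in auto)
  finally show ?thesis
    by (simp add: sum_distrib_left prod.distrib mult_ac)
qed

end

theory Submission
  imports Defs
begin

text \<open>
  Since \<open>\<bar>x\<bar> = 1\<close>, the exponent \<open>\<bar>y - y' x\<bar>\<^sup>2 = \<bar>y\<bar>\<^sup>2 + \<bar>y'\<bar>\<^sup>2 - 2 Re (y\<^sup>* y' x)\<close> depends on \<open>x\<close> only
  through its last term, so each link density is a positive factor independent of \<open>x\<close> times
  \<open>exp (Re (y\<^sup>* y' x) / N\<^sub>0)\<close>. These factors come out of the relay sums, and
  the likelihood is a positive constant times the exponential of the decision metric.
\<close>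

lemma norm_psk_point [simp]: "cmod (psk_point M \<theta> i) = 1"
  by (simp add: psk_point_def)

lemma norm_psk: "x \<in> psk M \<theta> \<Longrightarrow> cmod x = 1"
  by (auto simp: psk_def)

text \<open>The part of a link density that is the same for every symbol on the unit circle.\<close>

definition link_const :: "real \<Rightarrow> complex \<Rightarrow> complex \<Rightarrow> real" where
  "link_const N0 y' y = exp (- ((cmod y)\<^sup>2 + (cmod y')\<^sup>2) / (2 * N0)) / (2 * pi * N0)"

lemma link_const_pos: "N0 > 0 \<Longrightarrow> link_const N0 y' y > 0"
  by (simp add: link_const_def)

lemma norm_diff_mult_sq:
  fixes x y y' :: complex
  assumes "cmod x = 1"
  shows "(cmod (y - y' * x))\<^sup>2 = (cmod y)\<^sup>2 + (cmod y')\<^sup>2 - 2 * Re (cnj y * y' * x)"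
proof -
  have "(cmod (y - y' * x))\<^sup>2 = (cmod y)\<^sup>2 + (cmod (y' * x))\<^sup>2 - 2 * Re (cnj y * (y' * x))"
    unfolding cmod_power2 by (simp add: power2_eq_square algebra_simps)
  then show ?thesis
    by (simp add: norm_mult assms mult.assoc)
qed

lemma link_density_unit:
  assumes "N0 > 0" and "cmod x = 1"
  shows "link_density N0 y' y x = link_const N0 y' y * exp (1 / N0 * Re (cnj y * y' * x))"
proof -
  \<comment> \<open>The 2 of the variance \<open>2 * N0\<close> cancels the 2 of the cross term,
    hence the weight \<open>1 / N0\<close> in the metric.\<close>
  have "- (cmod (y - y' * x))\<^sup>2 / (2 * N0) =
      - ((cmod y)\<^sup>2 + (cmod y')\<^sup>2) / (2 * N0) + 1 / N0 * Re (cnj y * y' * x)"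
    unfolding norm_diff_mult_sq[OF assms(2)] using assms(1) by (simp add: field_simps)
  then show ?thesis
    unfolding link_density_def cn_density_def link_const_def
    by (simp only: exp_add) (simp add: mult_ac)
qed

text \<open>\<open>is_arg_max\<close> only forbids a strictly better competitor within
  \<open>P\<close>, so agreement of strict comparisons on \<open>P\<close> suffices; outside
  \<open>P\<close> the two functions may be unrelated.\<close>

lemma is_arg_max_transform:
  fixes f :: "'a \<Rightarrow> 'b::linorder" and g :: "'a \<Rightarrow> 'c::linorder"
  assumes "\<And>x y. P x \<Longrightarrow> P y \<Longrightarrow> f x < f y \<longleftrightarrow> g x < g y"
  shows "is_arg_max f P = is_arg_max g P"
  using assms by (fastforce simp: is_arg_max_def fun_eq_iff)

theorem mainTheorem1:
  fixes N M :: nat and \<theta> :: real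
    and \<epsilon> Nrd :: "nat \<Rightarrow> real" and Nsd :: real
    and ysd' ysd :: complex and yrd' yrd :: "nat \<Rightarrow> complex"
  assumes "N \<ge> 1" and "M \<ge> 2"
    and "\<And>m. m \<in> {1..N} \<Longrightarrow> 0 < \<epsilon> m \<and> \<epsilon> m < 1"
    and "Nsd > 0"
    and "\<And>m. m \<in> {1..N} \<Longrightarrow> Nrd m > 0"
  shows "{x. is_arg_max (likelihood N M \<theta> \<epsilon> Nsd Nrd ysd' ysd yrd' yrd) (\<lambda>x. x \<in> psk M \<theta>) x} =
    {x. is_arg_max
       (\<lambda>x. 1 / Nsd * Re (cnj ysd * ysd' * x) +
          (\<Sum>m=1..N. ln (
             (1 - \<epsilon> m) * exp (1 / Nrd m * Re (cnj (yrd m) * yrd' m * x)) +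
             \<epsilon> m / (real M - 1) *
               (\<Sum>i | i \<in> {1..M} \<and> psk_point M \<theta> i \<noteq> x.
                  exp (1 / Nrd m * Re (cnj (yrd m) * yrd' m * psk_point M \<theta> i))))))
       (\<lambda>x. x \<in> psk M \<theta>) x}"
proof -
  define G where "G m x = (1 - \<epsilon> m) * exp (1 / Nrd m * Re (cnj (yrd m) * yrd' m * x)) +
      \<epsilon> m / (real M - 1) * (\<Sum>i | i \<in> {1..M} \<and> psk_point M \<theta> i \<noteq> x.
        exp (1 / Nrd m * Re (cnj (yrd m) * yrd' m * psk_point M \<theta> i)))" for m x
  define J where "J x = 1 / Nsd * Re (cnj ysd * ysd' * x) + (\<Sum>m=1..N. ln (G m x))" for x
  define C where "C = link_const Nsd ysd' ysd * (\<Prod>m=1..N. link_const (Nrd m) (yrd' m) (yrd m))"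
  have C: "C > 0"
    unfolding C_def using assms(4,5) by (intro mult_pos_pos prod_pos link_const_pos ballI)
  \<comment> \<open>Positivity is what lets \<open>exp\<close> undo \<open>ln\<close> below. It
    comes from the first summand, as \<epsilon> m < 1; the second is only shown to be
    nonnegative.\<close>
  have G: "G m x > 0" if "m \<in> {1..N}" for m x
    unfolding G_def using assms(2) assms(3)[OF that]
    by (intro add_pos_nonneg mult_pos_pos mult_nonneg_nonneg sum_nonneg) auto
  have L: "likelihood N M \<theta> \<epsilon> Nsd Nrd ysd' ysd yrd' yrd x = C * exp (J x)"
    if x: "x \<in> psk M \<theta>" for x
  proof -
    \<comment> \<open>\<open>x\<close> and all other constellation points have modulus 1, so every
      term of the mixture carries the same \<open>link_const\<close>, which factors out.\<close>
    have "(1 - \<epsilon> m) * link_density (Nrd m) (yrd' m) (yrd m) x + \<epsilon> m / (real M - 1) *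
          (\<Sum>i | i \<in> {1..M} \<and> psk_point M \<theta> i \<noteq> x.
             link_density (Nrd m) (yrd' m) (yrd m) (psk_point M \<theta> i)) =
        link_const (Nrd m) (yrd' m) (yrd m) * exp (ln (G m x))" if m: "m \<in> {1..N}" for m
      unfolding exp_ln[OF G[OF m]] unfolding G_def
      by (simp only: link_density_unit[OF assms(5)[OF m]] norm_psk[OF x] norm_psk_point
          sum_distrib_left[symmetric] distrib_left mult.left_commute)
    then show ?thesis
      unfolding likelihood_def link_density_unit[OF assms(4) norm_psk[OF x]] C_def J_def
      by (simp add: prod.distrib exp_add exp_sum mult_ac)
  qed
  have "is_arg_max (likelihood N M \<theta> \<epsilon> Nsd Nrd ysd' ysd yrd' yrd) (\<lambda>x. x \<in> psk M \<theta>) =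
      is_arg_max J (\<lambda>x. x \<in> psk M \<theta>)"
    \<comment> \<open>On the constellation, where \<open>L\<close> applies, t \<mapsto> C * exp t is
      strictly increasing, so strict comparisons are those of \<open>J\<close>.\<close>
    using C by (intro is_arg_max_transform) (simp add: L)
  then show ?thesis
    by (simp only: J_def[abs_def] G_def)
qed

end
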